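(* Let $C_1,C_2>0$ be absolute constants such that for all integers $N\ge2$, all $\nu,\tau>0$, all mean-zero $g\in L^4(\mathbb T^2)$ and all $g_1\in L^{4/3}(\mathbb T^2)$, $$\|(1+\nu\tau\Delta^2)^{-1}g\|_{L^\infty(\mathbb T^2)}\le C_1(\nu\tau)^{-\frac18}\|g\|_{L^4(\mathbb T^2)},\qquad \|\tau\Delta(1+\nu\tau\Delta^2)^{-1}\Pi_Ng_1\|_{L^\infty(\mathbb T^2)}\le C_2\,\tau(\nu\tau)^{-\frac78}\|g_1\|_{L^{4/3}(\mathbb T^2)}.$$ Let $\nu>0$ and let $N\ge 2$ be an integer. Assume $u_0\in H^1(\mathbb T^2)$ is real-valued and has mean zero, let $u^0=\Pi_Nu_0$, and assume $\|u^0\|_{L^\infty(\mathbb T^2)}=L_0<\infty$ with $L_0\ne0$. Put $E_0=\mathcal E(u^0)$, $$\alpha_1=C_1\sqrt{1+2\sqrt{E_0}},\qquad \alpha_2=2C_2\sqrt{E_0}\,\sqrt{1+2\sqrt{E_0}},$$ $$\tau_{\max}=\min\Big\{\frac{8\nu}{9L_0^4},\ \tau_{\max}^{(1)}\Big\},\qquad \tau_{\max}^{(1)}=0.04\,\nu^3\min\{\alpha_1^{-8},\ \alpha_2^{-\frac83}\}.$$ Then for any $0<\tau\le\tau_{\max}$, the solution of the scheme $$\frac{u^{n+1}-u^n}{\tau}=-\nu\Delta^2u^{n+1}+\Delta\Pi_N(f(u^n)),\quad n\ge 0,$$ satisfies $\mathcal E(u^{n+1})\le\mathcal E(u^n)$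 for all $n\ge 0$.
   Context: $\mathbb T^2=\mathbb R^2/\mathbb Z^2=[-\frac12,\frac12)^2$ is the $1$-periodic torus. $f(u)=u^3-u$. The energy is $$\mathcal E(u)=\int_{\mathbb T^2}\Big(\tfrac12\nu|\nabla u|^2+\tfrac14(u^2-1)^2\Big)dx .$$ Fourier convention: $\hat g(k)=\int_{\mathbb T^2}g(x)e^{-2\pi i k\cdot x}dx$, $g(x)=\sum_{k\in\mathbb Z^2}\hat g(k)e^{2\pi i k\cdot x}$. $\Pi_N$ is the projection onto $X_N=\operatorname{Span}\{\cos(2\pi k\cdot x),\sin(2\pi k\cdot x):k\in\mathbb Z^2,\ |k|_\infty\le N\}$, where $|k|_\infty=\max_j|k_j|$; i.e. $\Pi_N$ truncates to Fourier modes with $|k|_\infty\le N$. $(1+\nu\tau\Delta^2)^{-1}$ and $\tau\Delta(1+\nu\tau\Delta^2)^{-1}$ are the Fourier multipliers with symbols $(1+\nu\tau(2\pi|k|)^4)^{-1}$ and $-\tau(2\pi|k|)^2(1+\nu\tau(2\pi|k|)^4)^{-1}$. Each $u^{n+1}\in X_N$ is uniquely determined by $u^n$ through the scheme. *)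

theory Defs
  imports "HOL-Analysis.Analysis" "HOL-Probability.Essential_Supremum"
begin

text \<open>
  The torus \<open>\<real>\<^sup>2/\<int>\<^sup>2\<close> is represented by its fundamental cell with Lebesgue measure.  A function on the
  torus is a function on \<^typ>\<open>real^2\<close> of which only the values on the cell matter; functions to which
  derivatives are applied are trigonometric polynomials and hence periodic on the whole plane.
\<close>

definition torus :: "(real^2) measure" where
  "torus = lebesgue_on {x. \<forall>j. - 1/2 \<le> x $ j \<and> x $ j < 1/2}"

definition in_Lp :: "real \<Rightarrow> (real^2 \<Rightarrow> real) \<Rightarrow> bool" where
  "in_Lp p g \<longleftrightarrow> g \<in> borel_measurable torus \<and> integrable torus (\<lambda>x. \<bar>g x\<bar> powr p)"

definition Lp_norm :: "real \<Rightarrow> (real^2 \<Rightarrow> real) \<Rightarrow> real" where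
  "Lp_norm p g = (LINT x|torus. \<bar>g x\<bar> powr p) powr (1/p)"

definition Linf_norm :: "(real^2 \<Rightarrow> real) \<Rightarrow> ereal" where
  "Linf_norm g = esssup torus (\<lambda>x. ereal \<bar>g x\<bar>)"

definition mean_zero :: "(real^2 \<Rightarrow> real) \<Rightarrow> bool" where
  "mean_zero g \<longleftrightarrow> (LINT x|torus. g x) = 0"


definition rvec :: "int^2 \<Rightarrow> real^2" where
  "rvec k = (\<chi> j. real_of_int (k $ j))"

definition fourier_coeff :: "(real^2 \<Rightarrow> real) \<Rightarrow> int^2 \<Rightarrow> complex" where
  "fourier_coeff g k = (LINT x|torus. complex_of_real (g x) * cis (- (2 * pi * (rvec k \<bullet> x))))"

text \<open>
  All symbols \<open>m\<close> used here are real and even, so that for real-valued \<open>g\<close> the Fourier series is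
  already real and \<^const>\<open>Re\<close> is only a change of type; see \<open>fourier_multiplier_of_real\<close>.
  For the resolvent symbols the series is absolutely convergent.
\<close>

definition fourier_multiplier :: "(int^2 \<Rightarrow> real) \<Rightarrow> (real^2 \<Rightarrow> real) \<Rightarrow> real^2 \<Rightarrow> real" where
  "fourier_multiplier m g x =
     Re (\<Sum>\<^sub>\<infinity>k\<in>UNIV. complex_of_real (m k) * fourier_coeff g k * cis (2 * pi * (rvec k \<bullet> x)))"

lemma fourier_multiplier_of_real:
  assumes "\<And>k. m (- k) = m k"
  shows "complex_of_real (fourier_multiplier m g x) =
     (\<Sum>\<^sub>\<infinity>k\<in>UNIV. complex_of_real (m k) * fourier_coeff g k * cis (2 * pi * (rvec k \<bullet> x)))"
proof -
  define F where "F = (\<lambda>k. complex_of_real (m k) * fourier_coeff g k * cis (2 * pi * (rvec k \<bullet> x)))"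
  have r: "rvec (- k) = - rvec k" for k
    by (simp add: rvec_def vec_eq_iff)
  have c: "cnj (fourier_coeff g k) = fourier_coeff g (- k)" for k
    unfolding fourier_coeff_def Bochner_Integration.integral_cnj[symmetric]
    by (simp add: r cis_cnj)
  have F: "cnj (F k) = F (- k)" for k
    by (simp add: F_def c r assms cis_cnj)
  have "cnj (infsum F UNIV) = infsum (\<lambda>k. F (- k)) UNIV"
    by (simp add: F flip: infsum_cnj)
  also have "\<dots> = infsum F UNIV"
    by (rule infsum_reindex_bij_betw) (simp add: bij_uminus)
  finally have "infsum F UNIV \<in> \<real>"
    by (simp add: Reals_cnj_iff)
  then show ?thesis
    unfolding fourier_multiplier_def F_def[symmetric] by simp
qed

definition modes :: "nat \<Rightarrow> (int^2) set" where
  "modes N = {k. \<forall>j. \<bar>k $ j\<bar> \<le> int N}"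

definition trig_space :: "nat \<Rightarrow> (real^2 \<Rightarrow> real) set" where
  "trig_space N = {g. \<exists>a b. g = (\<lambda>x. \<Sum>k\<in>modes N.
     a k * cos (2 * pi * (rvec k \<bullet> x)) + b k * sin (2 * pi * (rvec k \<bullet> x)))}"

definition proj :: "nat \<Rightarrow> (real^2 \<Rightarrow> real) \<Rightarrow> real^2 \<Rightarrow> real" where
  "proj N = fourier_multiplier (\<lambda>k. if k \<in> modes N then 1 else 0)"

text \<open>The operators \<open>(1 + \<nu>\<tau>\<Delta>\<^sup>2)\<^sup>-\<^sup>1\<close> and \<open>\<tau>\<Delta>(1 + \<nu>\<tau>\<Delta>\<^sup>2)\<^sup>-\<^sup>1\<close>.\<close>

definition resolvent :: "real \<Rightarrow> real \<Rightarrow> (real^2 \<Rightarrow> real) \<Rightarrow> real^2 \<Rightarrow> real" where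
  "resolvent \<nu> \<tau> = fourier_multiplier (\<lambda>k. 1 / (1 + \<nu> * \<tau> * (2 * pi * norm (rvec k)) ^ 4))"

definition laplace_resolvent :: "real \<Rightarrow> real \<Rightarrow> (real^2 \<Rightarrow> real) \<Rightarrow> real^2 \<Rightarrow> real" where
  "laplace_resolvent \<nu> \<tau> = fourier_multiplier
     (\<lambda>k. - \<tau> * (2 * pi * norm (rvec k))\<^sup>2 / (1 + \<nu> * \<tau> * (2 * pi * norm (rvec k)) ^ 4))"

text \<open>The Sobolev space \<open>H\<^sup>1\<close> of the torus, by square-summability of \<open>(1 + (2\<pi>|k|)\<^sup>2)\<^sup>1\<^sup>/\<^sup>2\<close> times the coefficients.\<close>

definition in_H1 :: "(real^2 \<Rightarrow> real) \<Rightarrow> bool" where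
  "in_H1 g \<longleftrightarrow> in_Lp 2 g \<and>
     (\<lambda>k. (1 + (2 * pi * norm (rvec k))\<^sup>2) * (cmod (fourier_coeff g k))\<^sup>2) summable_on UNIV"


definition partial :: "2 \<Rightarrow> (real^2 \<Rightarrow> real) \<Rightarrow> real^2 \<Rightarrow> real" where
  "partial j g x = deriv (\<lambda>t. g (x + t *\<^sub>R axis j 1)) 0"

definition laplacian :: "(real^2 \<Rightarrow> real) \<Rightarrow> real^2 \<Rightarrow> real" where
  "laplacian g x = (\<Sum>j\<in>UNIV. partial j (partial j g) x)"

definition ac_f :: "real \<Rightarrow> real" where
  "ac_f u = u ^ 3 - u"

text \<open>The gradient is the classical one; the energy is only applied to trigonometric polynomials.\<close>

definition energy :: "real \<Rightarrow> (real^2 \<Rightarrow> real) \<Rightarrow> real" where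
  "energy \<nu> u = (LINT x|torus. 1/2 * \<nu> * (\<Sum>j\<in>UNIV. (partial j u x)\<^sup>2) + 1/4 * ((u x)\<^sup>2 - 1)\<^sup>2)"

end

theory Submission
  imports Defs
begin

text \<open>
  Let \<open>u\<close> and \<open>v\<close> be consecutive iterates and \<open>w = v - u\<close>.  Pairing the scheme with \<open>(-\<Delta>)\<^sup>-\<^sup>1w\<close> and expanding the
  energy about \<open>u\<close> gives, with norms in \<open>L\<^sup>2\<close>,
  \<open>E(v) - E(u) = - |\<nabla>\<^sup>-\<^sup>1w|\<^sup>2 / \<tau> - \<nu>/2 |\<nabla>w|\<^sup>2 + \<integral> w\<^sup>2 (3/4 u\<^sup>2 + uv/2 + v\<^sup>2/4 - 1/2)\<close>.
  Interpolating \<open>|w|\<^sup>2\<close> between the first two terms shows that together they dissipate at least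
  \<open>sqrt (2\<nu>/\<tau>) |w|\<^sup>2\<close> (\<open>mode_dissipation\<close>).  The energy therefore decreases once both \<open>u\<^sup>2\<close> and \<open>v\<^sup>2\<close> are at most
  \<open>(2/3) sqrt (2\<nu>/\<tau>)\<close> almost everywhere (\<open>energy_decay\<close>).

  These bounds come from the energy itself.  The step can be solved as \<open>v = R u + S f(u)\<close>, with \<open>R\<close> and
  \<open>S\<close> the two resolvent multipliers (\<open>scheme_step_resolvent\<close>), and the assumed estimates bound \<open>v\<close> uniformly
  by the norms of \<open>u\<close> in \<open>L\<^sup>4\<close> and of \<open>f(u)\<close> in \<open>L\<^sup>4\<^sup>/\<^sup>3\<close>.  Both norms are controlled by \<open>E(u)\<close>
  (\<open>L4_norm_bound\<close>, \<open>ac_f_L43_norm_bound\<close>), so as long as \<open>E(u) \<le> E0\<close> the bound on \<open>v\<close> is the same at every step;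
  the restriction on \<open>\<tau>\<close> puts it below the threshold (\<open>step_size_bound\<close>).  The initial datum is covered by the
  restriction involving its sup norm.  An induction carrying the mean, the energy bound and the pointwise
  bound then closes the argument.

  All functions to which the scheme is applied are trigonometric polynomials, so everything except the
  nonlinear term is expressed by finite Fourier sums.
\<close>

section \<open>Integration over the torus\<close>

abbreviation cell :: "(real^2) set" where
  "cell \<equiv> {x. \<forall>j. - 1/2 \<le> x $ j \<and> x $ j < 1/2}"

lemma cell_borel [measurable]: "cell \<in> sets borel"
proof -
  have "cell = (\<Inter>j. {x. - 1/2 \<le> x $ j} \<inter> {x. x $ j < 1/2})"
    by auto
  moreover have "{x::real^2. - 1/2 \<le> x $ j} \<in> sets borel" for j
    by (intro borel_closed closed_Collect_le continuous_intros)
  moreover have "{x::real^2. x $ j < 1/2} \<in> sets borel" for j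
    by (intro borel_open open_Collect_less continuous_intros)
  ultimately show ?thesis
    by auto
qed

lemma space_torus: "space torus = cell"
  by (simp add: torus_def)

lemma borel_measurable_torus:
  "f \<in> borel_measurable borel \<Longrightarrow> f \<in> borel_measurable torus"
  unfolding torus_def by (intro measurable_restrict_space1 measurable_completion) simp

lemma integral_torus:
  fixes f :: "real^2 \<Rightarrow> 'b::{banach, second_countable_topology}"
  assumes "f \<in> borel_measurable borel"
  shows "(LINT x|torus. f x) = (LINT x|lborel. indicator cell x *\<^sub>R f x)"
proof -
  have "(LINT x|torus. f x) = (LINT x|lebesgue. indicator cell x *\<^sub>R f x)"
    unfolding torus_def by (rule integral_restrict_space) (use cell_borel in auto)
  also have "\<dots> = (LINT x|lborel. indicator cell x *\<^sub>R f x)"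
    using assms by (intro integral_completion borel_measurable_scaleR) (auto simp: cell_borel)
  finally show ?thesis .
qed

lemma cell_subset_cbox: "cell \<subseteq> cbox (\<chi> j. - 1/2) (\<chi> j. 1/2)"
  by (auto simp: mem_box_cart less_imp_le)

lemma finite_measure_torus: "finite_measure torus"
proof
  have "emeasure lborel cell \<le> emeasure lborel (cbox (\<chi> j. - 1/2) (\<chi> j. 1/2) :: (real^2) set)"
    by (intro emeasure_mono cell_subset_cbox) simp
  also have "\<dots> < \<infinity>"
    by (rule emeasure_lborel_cbox_finite)
  finally have "emeasure lborel cell < \<infinity>" .
  moreover have "emeasure torus (space torus) = emeasure lborel cell"
    unfolding space_torus unfolding torus_def
    by (subst emeasure_restrict_space) (use cell_borel in auto)
  ultimately show "emeasure torus (space torus) \<noteq> \<infinity>"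
    by auto
qed

lemma integrable_torus_continuous:
  fixes f :: "real^2 \<Rightarrow> 'b::{banach, second_countable_topology}"
  assumes "continuous_on UNIV f"
  shows "integrable torus f"
proof -
  interpret finite_measure torus by (rule finite_measure_torus)
  have "compact (f ` cbox (\<chi> j. - 1/2) (\<chi> j. 1/2))"
    by (intro compact_continuous_image compact_cbox continuous_on_subset[OF assms]) auto
  then obtain B where B: "\<And>x. x \<in> cbox (\<chi> j. - 1/2) (\<chi> j. 1/2) \<Longrightarrow> norm (f x) \<le> B"
    by (metis (mono_tags, lifting) bounded_iff compact_imp_bounded image_eqI)
  show ?thesis
  proof (rule integrable_const_bound[where B = B])
    show "AE x in torus. norm (f x) \<le> B"
      using B cell_subset_cbox by (intro AE_I2) (auto simp: space_torus)
    show "f \<in> borel_measurable torus"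
      by (intro borel_measurable_torus borel_measurable_continuous_onI assms)
  qed
qed

section \<open>Fourier modes and trigonometric polynomials\<close>

definition mode :: "int^2 \<Rightarrow> real^2 \<Rightarrow> complex" where
  "mode k x = cis (2 * pi * (rvec k \<bullet> x))"

lemma continuous_mode [continuous_intros]: "continuous_on A (mode k)"
  unfolding mode_def cis_conv_exp by (intro continuous_intros)

lemma cis_sum: "finite A \<Longrightarrow> cis (\<Sum>i\<in>A. f i) = (\<Prod>i\<in>A. cis (f i))"
  by (induction A rule: finite_induct) (simp_all flip: cis_mult)

lemma integral_cis_interval:
  fixes m :: int
  shows "(LINT t|lborel. indicator {- 1/2..<1/2} t *\<^sub>R cis (2 * pi * (real_of_int m * t)))
    = (if m = 0 then 1 else 0)"
proof -
  define f where "f t = cis (2 * pi * (real_of_int m * t))" for t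
  define F where "F t = (if m = 0 then complex_of_real t
      else (- \<i> / complex_of_real (2 * pi * m)) * f t)" for t
  have cont: "continuous_on A f" for A
    unfolding f_def cis_conv_exp by (intro continuous_intros)
  have f': "(f has_vector_derivative complex_of_real (2 * pi * m) * \<i> * f t) (at t within A)" for t A
    unfolding f_def has_vector_derivative_def
    by (auto intro!: derivative_eq_intros ext simp: scaleR_conv_of_real)
  have F: "(F has_vector_derivative f t) (at t within A)" for t A
  proof (cases "m = 0")
    case True
    then show ?thesis
      unfolding F_def f_def by (auto intro!: derivative_eq_intros)
  next
    case False
    then have "(- \<i> / complex_of_real (2 * pi * m)) * (complex_of_real (2 * pi * m) * \<i> * f t) = f t"
      by (simp add: field_simps)
    with has_vector_derivative_mult_right[OF f', of "- \<i> / complex_of_real (2 * pi * m)" t A] False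
    show ?thesis
      unfolding F_def by simp
  qed
  have "(LINT t|lborel. indicator {- 1/2..<1/2} t *\<^sub>R f t)
      = (LINT t|lborel. indicator {- 1/2..1/2} t *\<^sub>R f t)"
  proof (rule integral_cong_AE)
    have "AE t in lborel. t \<noteq> (1/2::real)"
      by (rule AE_lborel_singleton)
    then show "AE t in lborel. indicator {- 1/2..<1/2} t *\<^sub>R f t = indicator {- 1/2..1/2} t *\<^sub>R f t"
      by eventually_elim (auto simp: indicator_def)
  qed (use cont borel_measurable_continuous_onI in \<open>auto intro!: borel_measurable_scaleR\<close>)
  also have "\<dots> = F (1/2) - F (- 1/2)"
    by (rule integral_FTC_Icc) (use F cont in auto)
  also have "\<dots> = (if m = 0 then 1 else 0)"
  proof (cases "m = 0")
    case False
    have "f (1/2) = f (- 1/2)"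
      unfolding f_def complex_eq_iff
      using sin_npi_int[of m] cos_npi_int by (simp add: mult.commute)
    with False show ?thesis
      by (simp add: F_def)
  qed (simp add: F_def)
  finally show ?thesis
    unfolding f_def .
qed

text \<open>
  The integrand is a product over the two coordinates and Lebesgue measure on the plane is a product
  measure, so the integral factors into one-dimensional ones over a full period.
\<close>
lemma integral_mode: "(LINT x|torus. mode k x) = (if k = 0 then 1 else 0)"
proof -
  let ?h = "\<lambda>b t. indicator {- 1/2..<1/2} t *\<^sub>R cis (2 * pi * ((rvec k \<bullet> b) * t))"
  have Basis: "(Basis :: (real^2) set) = (\<lambda>j. axis j 1) ` UNIV"
    by (auto simp: Basis_vec_def)
  have inj: "inj (\<lambda>j. axis j 1 :: real^2)"
    by (auto simp: inj_def axis_eq_axis)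
  interpret product_sigma_finite "\<lambda>b::real^2. lborel :: real measure" ..
  have split: "indicator cell x *\<^sub>R mode k x = (\<Prod>b\<in>Basis. ?h b (x \<bullet> b))" for x
  proof -
    have "(\<Prod>b\<in>Basis. ?h b (x \<bullet> b))
        = complex_of_real (\<Prod>b\<in>Basis. indicator {- 1/2..<1/2} (x \<bullet> b))
          * cis (\<Sum>b\<in>Basis. 2 * pi * ((rvec k \<bullet> b) * (x \<bullet> b)))"
      by (simp add: cis_sum scaleR_conv_of_real prod.distrib)
    also have "(\<Sum>b\<in>Basis. 2 * pi * ((rvec k \<bullet> b) * (x \<bullet> b))) = 2 * pi * (rvec k \<bullet> x)"
      by (subst (3) euclidean_inner) (simp add: sum_distrib_left)
    also have "(\<Prod>b\<in>Basis. indicator {- 1/2..<1/2} (x \<bullet> b)) = (indicator cell x :: real)"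
      unfolding Basis using inj
      by (subst prod.reindex) (auto simp: inner_axis indicator_def)
    finally show ?thesis
      by (simp add: mode_def scaleR_conv_of_real)
  qed
  have meas: "(\<lambda>f. \<Sum>b\<in>Basis. f b *\<^sub>R b) \<in> (\<Pi>\<^sub>M b\<in>Basis. lborel) \<rightarrow>\<^sub>M (borel :: (real^2) measure)"
    by measurable
  have meas2: "(\<lambda>x. indicator cell x *\<^sub>R mode k x) \<in> borel_measurable borel"
    by (intro borel_measurable_scaleR borel_measurable_continuous_onI continuous_intros
        borel_measurable_indicator cell_borel)
  have "(LINT x|torus. mode k x) = (LINT x|lborel. indicator cell x *\<^sub>R mode k x)"
    by (intro integral_torus borel_measurable_continuous_onI continuous_intros)
  also have "\<dots> = (LINT f|(\<Pi>\<^sub>M b\<in>Basis. lborel). (\<Prod>b\<in>Basis. ?h b ((\<Sum>b\<in>Basis. f b *\<^sub>R b) \<bullet> b)))"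
    by (subst lborel_eq, subst integral_distr[OF meas meas2]) (simp only: split)
  also have "\<dots> = (LINT f|(\<Pi>\<^sub>M b\<in>Basis. lborel). (\<Prod>b\<in>Basis. ?h b (f b)))"
    by (intro Bochner_Integration.integral_cong prod.cong) auto
  also have "\<dots> = (\<Prod>b\<in>Basis. LINT t|lborel. ?h b t)"
  proof (rule product_integral_prod)
    fix b :: "real^2" assume "b \<in> Basis"
    have "integrable lborel (\<lambda>t. indicator {- 1/2..1/2} t *\<^sub>R cis (2 * pi * ((rvec k \<bullet> b) * t)))"
      unfolding cis_conv_exp
      by (intro borel_integrable_compact continuous_intros) auto
    then show "integrable lborel (?h b)"
      by (rule Bochner_Integration.integrable_bound)
         (auto simp: indicator_def cis_conv_exp intro!: borel_measurable_scaleR borel_measurable_continuous_onI continuous_intros)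
  qed auto
  also have "\<dots> = (\<Prod>j\<in>UNIV. if k $ j = 0 then 1 else 0)"
    unfolding Basis using inj
    by (subst prod.reindex) (auto simp: inner_axis rvec_def integral_cis_interval[simplified])
  also have "\<dots> = (if k = 0 then 1 else 0)"
    by (auto simp: vec_eq_iff)
  finally show ?thesis .
qed

lemma fourier_coeff_eq: "fourier_coeff g k = (LINT x|torus. complex_of_real (g x) * cnj (mode k x))"
  by (simp add: fourier_coeff_def mode_def cis_cnj)

lemma mode_mult_cnj: "mode k x * cnj (mode l x) = mode (k - l) x"
  by (simp add: mode_def cis_cnj cis_mult rvec_def inner_vec_def algebra_simps sum_subtractf sum_distrib_left)

lemma cnj_mode: "cnj (mode k x) = mode (- k) x"
  by (simp add: mode_def cis_cnj rvec_def inner_vec_def sum_negf)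

lemma finite_modes [simp]: "finite (modes N)"
proof -
  let ?I = "{- int N..int N}"
  have "modes N \<subseteq> (\<lambda>(a, b). \<chi> j. if j = 1 then a else b) ` (?I \<times> ?I)"
  proof
    fix k assume "k \<in> modes N"
    then show "k \<in> (\<lambda>(a, b). \<chi> j. if j = 1 then a else b) ` (?I \<times> ?I)"
      by (intro image_eqI[of _ _ "(k $ 1, k $ 2)"])
         (auto simp: modes_def vec_eq_iff forall_2 abs_le_iff minus_le_iff)
  qed
  then show ?thesis
    by (rule finite_subset) auto
qed

lemma uminus_modes: "- k \<in> modes N \<longleftrightarrow> k \<in> modes N"
  by (simp add: modes_def)

text \<open>
  By orthogonality of the modes, any expansion over \<^term>\<open>modes N\<close> is the Fourier expansion.  Every
  later computation of a coefficient is an application of this uniqueness.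
\<close>
lemma fourier_coeff_trig_poly:
  assumes g: "\<And>x. complex_of_real (g x) = (\<Sum>k\<in>modes N. c k * mode k x)"
  shows "fourier_coeff g k = (if k \<in> modes N then c k else 0)"
proof -
  have "fourier_coeff g k = (LINT x|torus. (\<Sum>l\<in>modes N. c l * mode (l - k) x))"
    by (simp add: fourier_coeff_eq g sum_distrib_right mult.assoc mode_mult_cnj)
  also have "\<dots> = (\<Sum>l\<in>modes N. c l * (LINT x|torus. mode (l - k) x))"
    by (subst Bochner_Integration.integral_sum)
       (auto intro!: integrable_torus_continuous continuous_intros)
  also have "\<dots> = (\<Sum>l\<in>modes N. if l = k then c l else 0)"
    by (intro sum.cong) (auto simp: integral_mode)
  finally show ?thesis
    by simp
qed

lemma trig_spaceI:
  assumes g: "\<And>x. complex_of_real (g x) = (\<Sum>k\<in>modes N. c k * mode k x)"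
  shows "g \<in> trig_space N"
proof -
  have "g x = (\<Sum>k\<in>modes N. Re (c k) * cos (2 * pi * (rvec k \<bullet> x))
      + (- Im (c k)) * sin (2 * pi * (rvec k \<bullet> x)))" for x
    using arg_cong[OF g[of x], of Re] by (simp add: mode_def)
  then have "g = (\<lambda>x. \<Sum>k\<in>modes N. Re (c k) * cos (2 * pi * (rvec k \<bullet> x))
      + (- Im (c k)) * sin (2 * pi * (rvec k \<bullet> x)))"
    by blast
  then show ?thesis
    unfolding trig_space_def mem_Collect_eq
    by (intro exI[of _ "\<lambda>k. Re (c k)"] exI[of _ "\<lambda>k. - Im (c k)"])
qed

text \<open>
  A cosine or sine at frequency \<open>k\<close> spreads over the modes \<open>k\<close> and \<open>-k\<close>, so the coefficients are obtained by
  symmetrising a given real representation.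
\<close>
lemma trig_space_expansion:
  assumes "g \<in> trig_space N"
  shows "complex_of_real (g x) = (\<Sum>k\<in>modes N. fourier_coeff g k * mode k x)"
proof -
  obtain a b where g: "g = (\<lambda>x. \<Sum>k\<in>modes N.
      a k * cos (2 * pi * (rvec k \<bullet> x)) + b k * sin (2 * pi * (rvec k \<bullet> x)))"
    using assms unfolding trig_space_def by auto
  \<comment> \<open>The real part of \<open>(a - \<i>b) e\<^sub>k\<close> is \<open>a cos + b sin\<close>; averaging with the conjugate, reindexed by \<open>k \<mapsto> -k\<close>, gives \<open>c\<close>.\<close>
  define c where "c k = (Complex (a k) (- b k) + cnj (Complex (a (- k)) (- b (- k)))) / 2" for k
  have c: "complex_of_real (g x) = (\<Sum>k\<in>modes N. c k * mode k x)" for x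
  proof -
    let ?d = "\<lambda>k. Complex (a k) (- b k) * mode k x"
    have "complex_of_real (g x) = complex_of_real (Re (\<Sum>k\<in>modes N. ?d k))"
      by (simp add: g mode_def)
    also have "\<dots> = ((\<Sum>k\<in>modes N. ?d k) + cnj (\<Sum>k\<in>modes N. ?d k)) / 2"
      by (simp only: complex_add_cnj) simp
    also have "cnj (\<Sum>k\<in>modes N. ?d k) = (\<Sum>k\<in>modes N. cnj (Complex (a k) (- b k)) * mode (- k) x)"
      by (simp add: cnj_mode)
    also have "\<dots> = (\<Sum>k\<in>modes N. cnj (Complex (a (- k)) (- b (- k))) * mode k x)"
      by (rule sum.reindex_bij_witness[where i = uminus and j = uminus]) (auto simp: uminus_modes)
    also have "((\<Sum>k\<in>modes N. ?d k) + \<dots>) / 2 = (\<Sum>k\<in>modes N. c k * mode k x)"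
      by (simp add: c_def sum_divide_distrib add_divide_distrib ring_distribs flip: sum.distrib)
    finally show ?thesis .
  qed
  show ?thesis
    unfolding c by (intro sum.cong) (auto simp: fourier_coeff_trig_poly[OF c])
qed

lemma continuous_trig_space: "g \<in> trig_space N \<Longrightarrow> continuous_on A g"
  by (auto simp: trig_space_def intro!: continuous_intros)

text \<open>
  Only one factor needs a finite expansion: integrating it term by term against the other produces the
  conjugate coefficients by their very definition.  This lets \<open>h\<close> be the nonlinear term, which has frequencies
  beyond those of the space, and makes the projection in the scheme invisible when testing against \<open>g\<close>.
\<close>
lemma parseval:
  assumes "g \<in> trig_space N" and "continuous_on UNIV h"
  shows "complex_of_real (LINT x|torus. g x * h x) = (\<Sum>k\<in>modes N. fourier_coeff g k * cnj (fourier_coeff h k))"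
proof -
  have "complex_of_real (LINT x|torus. g x * h x)
      = (LINT x|torus. (\<Sum>k\<in>modes N. fourier_coeff g k * (mode k x * complex_of_real (h x))))"
    by (simp add: trig_space_expansion[OF assms(1)] sum_distrib_right mult.assoc flip: integral_complex_of_real)
  also have "\<dots> = (\<Sum>k\<in>modes N. fourier_coeff g k * (LINT x|torus. mode k x * complex_of_real (h x)))"
    by (subst Bochner_Integration.integral_sum)
       (auto intro!: integrable_torus_continuous continuous_intros assms)
  also have "\<dots> = (\<Sum>k\<in>modes N. fourier_coeff g k * cnj (fourier_coeff h k))"
    unfolding fourier_coeff_eq Bochner_Integration.integral_cnj[symmetric] by (simp add: mult.commute)
  finally show ?thesis .
qed

lemma fourier_coeff_eq_0:
  assumes "g \<in> trig_space N" "k \<notin> modes N"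
  shows "fourier_coeff g k = 0"
  using fourier_coeff_trig_poly[OF trig_space_expansion[OF assms(1)], of k] assms(2) by simp

text \<open>
  Differentiation is carried out on the complex expansion.  The resulting sum is real because it is the
  derivative of a real function.
\<close>
lemma partial_expansion:
  assumes "g \<in> trig_space N"
  shows "complex_of_real (partial j g x) =
    (\<Sum>k\<in>modes N. (2 * pi * (k $ j) * \<i> * fourier_coeff g k) * mode k x)"
proof -
  let ?d = "\<Sum>k\<in>modes N. (2 * pi * (k $ j) * \<i> * fourier_coeff g k) * mode k x"
  let ?g = "\<lambda>t. g (x + t *\<^sub>R axis j 1)"
  have "((\<lambda>t. mode k (x + t *\<^sub>R axis j 1)) has_vector_derivative
      (2 * pi * (k $ j)) *\<^sub>R (\<i> * mode k x)) (at 0)" for k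
    unfolding mode_def has_vector_derivative_def
    by (auto intro!: derivative_eq_intros ext simp: inner_axis rvec_def inner_add_right mult_ac)
  then have D: "((\<lambda>t. complex_of_real (?g t)) has_vector_derivative ?d) (at 0)"
    unfolding trig_space_expansion[OF assms]
    by (auto intro!: derivative_eq_intros simp: scaleR_conv_of_real mult_ac)
  have "(?g has_vector_derivative Re ?d) (at 0)"
    using bounded_linear.has_vector_derivative[OF bounded_linear_Re D] by simp
  then have R: "(?g has_real_derivative Re ?d) (at 0)"
    by (simp add: has_real_derivative_iff_has_vector_derivative)
  have "((\<lambda>t. complex_of_real (?g t)) has_vector_derivative complex_of_real (Re ?d)) (at 0)"
    by (intro has_vector_derivative_of_real R)
  then have "complex_of_real (Re ?d) = ?d"
    using D vector_derivative_unique_at by blast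
  then show ?thesis
    unfolding partial_def DERIV_imp_deriv[OF R] .
qed

lemmas partial_trig_space = trig_spaceI[OF partial_expansion]

lemma fourier_coeff_partial:
  assumes "g \<in> trig_space N"
  shows "fourier_coeff (partial j g) k = 2 * pi * (k $ j) * \<i> * fourier_coeff g k"
  using fourier_coeff_trig_poly[OF partial_expansion[OF assms], of j k] fourier_coeff_eq_0[OF assms, of k]
  by auto

text \<open>
  The eigenvalue of \<open>-\<Delta>\<close> on the mode \<open>k\<close>.
\<close>
definition laplace_symbol :: "int^2 \<Rightarrow> real" where
  "laplace_symbol k = (2 * pi * norm (rvec k))\<^sup>2"

lemma laplace_symbol_eq: "laplace_symbol k = (\<Sum>j\<in>UNIV. (2 * pi * (k $ j))\<^sup>2)"
proof -
  have "(norm (rvec k))\<^sup>2 = (\<Sum>j\<in>UNIV. (real_of_int (k $ j))\<^sup>2)"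
    unfolding power2_norm_eq_inner by (simp add: inner_vec_def rvec_def power2_eq_square)
  then show ?thesis
    by (simp add: laplace_symbol_def power_mult_distrib sum_distrib_left)
qed

lemma laplacian_expansion:
  assumes "g \<in> trig_space N"
  shows "complex_of_real (laplacian g x) =
    (\<Sum>k\<in>modes N. (- laplace_symbol k * fourier_coeff g k) * mode k x)"
proof -
  have "complex_of_real (laplacian g x)
      = (\<Sum>k\<in>modes N. \<Sum>j\<in>UNIV. - complex_of_real ((2 * pi * (k $ j))\<^sup>2) * fourier_coeff g k * mode k x)"
    by (subst sum.swap)
       (simp add: laplacian_def partial_expansion[OF partial_trig_space[OF assms]]
          fourier_coeff_partial[OF assms] power2_eq_square mult_ac)
  then show ?thesis
    by (simp add: laplace_symbol_eq sum_distrib_right sum_negf)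
qed

lemmas laplacian_trig_space = trig_spaceI[OF laplacian_expansion]

lemma fourier_coeff_laplacian:
  assumes "g \<in> trig_space N"
  shows "fourier_coeff (laplacian g) k = - laplace_symbol k * fourier_coeff g k"
  using fourier_coeff_trig_poly[OF laplacian_expansion[OF assms], of k] fourier_coeff_eq_0[OF assms, of k]
  by auto

lemma trig_space_lincomb:
  assumes "g \<in> trig_space N" "h \<in> trig_space N"
  shows "(\<lambda>x. a * g x + b * h x) \<in> trig_space N" (is ?A)
    and "fourier_coeff (\<lambda>x. a * g x + b * h x) k
      = complex_of_real a * fourier_coeff g k + complex_of_real b * fourier_coeff h k" (is ?B)
proof -
  have *: "complex_of_real (a * g x + b * h x) = (\<Sum>k\<in>modes N.
      (complex_of_real a * fourier_coeff g k + complex_of_real b * fourier_coeff h k) * mode k x)" for x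
    by (simp add: trig_space_expansion[OF assms(1)] trig_space_expansion[OF assms(2)]
        sum_distrib_left sum.distrib ring_distribs mult.assoc)
  show ?A by (rule trig_spaceI[OF *])
  show ?B
    using fourier_coeff_trig_poly[OF *, of k] fourier_coeff_eq_0[OF assms(1), of k]
      fourier_coeff_eq_0[OF assms(2), of k] by auto
qed

text \<open>
  For data with finitely many nonzero coefficients the series defining a multiplier is a finite sum, so no
  question of convergence arises.
\<close>
lemma fourier_multiplier_finite_support:
  assumes even: "\<And>k. m (- k) = m k"
    and supp: "\<And>k. k \<notin> modes N \<Longrightarrow> complex_of_real (m k) * fourier_coeff g k = 0"
  shows "complex_of_real (fourier_multiplier m g x)
    = (\<Sum>k\<in>modes N. (complex_of_real (m k) * fourier_coeff g k) * mode k x)"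
proof -
  have "complex_of_real (fourier_multiplier m g x)
      = (\<Sum>\<^sub>\<infinity>k\<in>modes N. (complex_of_real (m k) * fourier_coeff g k) * mode k x)"
    unfolding fourier_multiplier_of_real[of m, OF even] mode_def
    by (rule infsum_cong_neutral) (use supp in auto)
  then show ?thesis
    by simp
qed

lemma proj_expansion:
  "complex_of_real (proj N g x) = (\<Sum>k\<in>modes N. fourier_coeff g k * mode k x)"
  unfolding proj_def
  by (subst fourier_multiplier_finite_support[where N = N]) (auto simp: uminus_modes)

lemmas proj_trig_space = trig_spaceI[OF proj_expansion]

lemma fourier_coeff_proj: "fourier_coeff (proj N g) k = (if k \<in> modes N then fourier_coeff g k else 0)"
  by (rule fourier_coeff_trig_poly[OF proj_expansion])

section \<open>Energy decay under pointwise bounds on both iterates\<close>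

lemma laplace_symbol_nonneg: "laplace_symbol k \<ge> 0"
  by (simp add: laplace_symbol_def)

text \<open>
  The polarised Dirichlet form, needed with two arguments because \<open>|\<nabla>v|\<^sup>2 - |\<nabla>u|\<^sup>2\<close> is
  \<open>2\<nabla>v\<cdot>\<nabla>w - |\<nabla>w|\<^sup>2\<close> for \<open>w = v - u\<close>.
\<close>
lemma dirichlet_form:
  assumes "g \<in> trig_space N" "h \<in> trig_space N"
  shows "complex_of_real (LINT x|torus. (\<Sum>j\<in>UNIV. partial j g x * partial j h x))
    = (\<Sum>k\<in>modes N. laplace_symbol k * (fourier_coeff g k * cnj (fourier_coeff h k)))"
proof -
  note T = partial_trig_space[OF assms(1)] partial_trig_space[OF assms(2)]
  have "(LINT x|torus. (\<Sum>j\<in>UNIV. partial j g x * partial j h x))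
      = (\<Sum>j\<in>UNIV. LINT x|torus. partial j g x * partial j h x)"
    by (intro Bochner_Integration.integral_sum integrable_torus_continuous continuous_intros
        continuous_trig_space[OF T(1)] continuous_trig_space[OF T(2)])
  also have "complex_of_real \<dots> = (\<Sum>j\<in>UNIV. \<Sum>k\<in>modes N.
      complex_of_real ((2 * pi * (k $ j))\<^sup>2) * (fourier_coeff g k * cnj (fourier_coeff h k)))"
    by (simp add: parseval[OF T(1) continuous_trig_space[OF T(2)]] fourier_coeff_partial[OF assms(1)]
        fourier_coeff_partial[OF assms(2)] power2_eq_square mult_ac)
  also have "\<dots> = (\<Sum>k\<in>modes N. laplace_symbol k * (fourier_coeff g k * cnj (fourier_coeff h k)))"
    by (subst sum.swap) (simp add: laplace_symbol_eq sum_distrib_right)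
  finally show ?thesis .
qed

definition scheme_step :: "nat \<Rightarrow> real \<Rightarrow> real \<Rightarrow> (real^2 \<Rightarrow> real) \<Rightarrow> (real^2 \<Rightarrow> real) \<Rightarrow> bool" where
  "scheme_step N \<nu> \<tau> u v \<longleftrightarrow> u \<in> trig_space N \<and> v \<in> trig_space N \<and>
    (\<forall>x. (v x - u x) / \<tau> =
      - \<nu> * laplacian (laplacian v) x + laplacian (proj N (\<lambda>y. ac_f (u y))) x)"

text \<open>
  On the modes retained by the projection the scheme decouples into scalar equations.
\<close>
lemma scheme_step_coeff:
  assumes "scheme_step N \<nu> \<tau> u v" "\<tau> > 0" "k \<in> modes N"
  shows "fourier_coeff v k - fourier_coeff u k =
    - \<tau> * laplace_symbol k * (\<nu> * laplace_symbol k * fourier_coeff v k + fourier_coeff (\<lambda>y. ac_f (u y)) k)"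
proof -
  let ?f = "\<lambda>y. ac_f (u y)"
  have u: "u \<in> trig_space N" and v: "v \<in> trig_space N"
    using assms(1) by (auto simp: scheme_step_def)
  have "(\<lambda>x. (1/\<tau>) * v x + (- 1/\<tau>) * u x)
      = (\<lambda>x. (- \<nu>) * laplacian (laplacian v) x + 1 * laplacian (proj N ?f) x)"
    using assms(1) by (auto simp: scheme_step_def fun_eq_iff diff_divide_distrib)
  then have "fourier_coeff (\<lambda>x. (1/\<tau>) * v x + (- 1/\<tau>) * u x) k
      = fourier_coeff (\<lambda>x. (- \<nu>) * laplacian (laplacian v) x + 1 * laplacian (proj N ?f) x) k"
    by simp
  then have "(fourier_coeff v k - fourier_coeff u k) / \<tau>
      = - laplace_symbol k * (\<nu> * laplace_symbol k * fourier_coeff v k + fourier_coeff ?f k)" (is "?l / _ = ?r")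
    unfolding trig_space_lincomb(2)[OF v u]
      trig_space_lincomb(2)[OF laplacian_trig_space[OF laplacian_trig_space[OF v]]
        laplacian_trig_space[OF proj_trig_space]]
    using assms(3)
    by (simp add: fourier_coeff_laplacian[OF v] fourier_coeff_laplacian[OF laplacian_trig_space[OF v]]
        fourier_coeff_laplacian[OF proj_trig_space] fourier_coeff_proj diff_divide_distrib algebra_simps)
  then show ?thesis
    using assms(2) by (simp add: field_simps)
qed

text \<open>
  This is the pairing of the scheme with \<open>(-\<Delta>)\<^sup>-\<^sup>1w\<close>, one frequency at a time, where \<open>l\<close> is the eigenvalue of
  \<open>-\<Delta>\<close> and \<open>V\<close>, \<open>W\<close>, \<open>F\<close> are the coefficients of \<open>v\<close>, \<open>w = v - u\<close> and the nonlinearity.  Dividing the equation by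
  \<open>\<tau>l\<close> expresses \<open>F\<close> through \<open>V\<close> and \<open>W\<close>; the cross terms cancel and leave \<open>-(\<nu>l/2 + 1/(\<tau>l))|W|\<^sup>2\<close>.  The
  arithmetic-geometric mean inequality removes the dependence on \<open>l\<close>.  The zero mode has to be excluded from
  the division, but there \<open>W\<close> vanishes.
\<close>
lemma mode_dissipation:
  fixes V W F :: complex and l \<nu> \<tau> :: real
  assumes "\<nu> > 0" "\<tau> > 0" "l \<ge> 0"
    and W: "W = - \<tau> * l * (\<nu> * l * V + F)"
  shows "\<nu> * l * Re (V * cnj W) - \<nu> / 2 * l * Re (W * cnj W) + Re (W * cnj F)
    + sqrt (2 * \<nu> / \<tau>) * Re (W * cnj W) \<le> 0"
proof (cases "l = 0")
  case True
  then show ?thesis using W by simp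
next
  case False
  with assms have l: "l > 0" by simp
  have "sqrt (2 * \<nu> / \<tau>) = 2 * sqrt ((\<nu> * l / 2) * (1 / (\<tau> * l)))"
    using l real_sqrt_mult[of 4 "\<nu> / (2 * \<tau>)"] by (simp add: field_simps)
  also have "\<dots> \<le> \<nu> * l / 2 + 1 / (\<tau> * l)"
    using arith_geo_mean_sqrt[of "\<nu> * l / 2" "1 / (\<tau> * l)"] l assms by simp
  finally have amgm: "sqrt (2 * \<nu> / \<tau>) \<le> \<nu> * l / 2 + 1 / (\<tau> * l)" .
  have F: "F = - complex_of_real (1 / (\<tau> * l)) * W - complex_of_real (\<nu> * l) * V"
    unfolding W using l assms by (simp add: field_simps)
  have "Re (W * cnj F) = - (1 / (\<tau> * l)) * Re (W * cnj W) - \<nu> * l * Re (V * cnj W)"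
    unfolding F by (simp add: algebra_simps add_divide_distrib)
  then have "\<nu> * l * Re (V * cnj W) - \<nu> / 2 * l * Re (W * cnj W) + Re (W * cnj F)
      + sqrt (2 * \<nu> / \<tau>) * Re (W * cnj W)
      = (sqrt (2 * \<nu> / \<tau>) - (\<nu> * l / 2 + 1 / (\<tau> * l))) * Re (W * cnj W)"
    by (simp add: algebra_simps)
  also have "\<dots> \<le> 0"
    using amgm by (intro mult_nonpos_nonneg) simp_all
  finally show ?thesis .
qed

text \<open>
  Exact Taylor expansion of the quartic potential about \<open>a\<close>.  Writing the quadratic and higher remainder as
  \<open>(b - a)\<^sup>2\<close> times a quadratic form in \<open>a\<close> and \<open>b\<close>, rather than in \<open>a\<close> and \<open>b - a\<close>, is what lets sup bounds for
  both iterates be used: its weights \<open>3/4\<close>, \<open>1/2\<close>, \<open>1/4\<close> add up to \<open>3/2\<close>.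
\<close>
lemma energy_density_diff:
  fixes a b :: real and p q :: "2 \<Rightarrow> real"
  shows "(1/2 * \<nu> * (\<Sum>j\<in>UNIV. (q j)\<^sup>2) + 1/4 * (b\<^sup>2 - 1)\<^sup>2)
      - (1/2 * \<nu> * (\<Sum>j\<in>UNIV. (p j)\<^sup>2) + 1/4 * (a\<^sup>2 - 1)\<^sup>2)
    = \<nu> * (\<Sum>j\<in>UNIV. q j * (q j - p j)) - \<nu> / 2 * (\<Sum>j\<in>UNIV. (q j - p j) * (q j - p j))
      + (b - a) * ac_f a + (b - a)\<^sup>2 * (3/4 * a\<^sup>2 + a * b / 2 + b\<^sup>2 / 4 - 1/2)"
  unfolding sum_2 ac_f_def by (simp add: field_simps power2_eq_square power3_eq_cube)

text \<open>
  If both iterates have squares at most \<open>(2/3) sqrt (2\<nu>/\<tau>)\<close>, the remainder of the potential is at most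
  \<open>sqrt (2\<nu>/\<tau>) w\<^sup>2\<close>, which is precisely what the linear part dissipates.  The constant \<open>2/3\<close> is the reciprocal of
  the total weight \<open>3/2\<close> in the remainder.
\<close>
lemma energy_decay:
  assumes step: "scheme_step N \<nu> \<tau> u v" and "\<nu> > 0" "\<tau> > 0"
    and "AE x in torus. (u x)\<^sup>2 \<le> 2/3 * sqrt (2 * \<nu> / \<tau>)"
    and "AE x in torus. (v x)\<^sup>2 \<le> 2/3 * sqrt (2 * \<nu> / \<tau>)"
  shows "energy \<nu> v \<le> energy \<nu> u"
proof -
  define S where "S = sqrt (2 * \<nu> / \<tau>)"
  define w where "w = (\<lambda>x. 1 * v x + (- 1) * u x)"
  let ?f = "\<lambda>x. ac_f (u x)"
  have u: "u \<in> trig_space N" and v: "v \<in> trig_space N"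
    using step by (auto simp: scheme_step_def)
  have w: "w \<in> trig_space N"
    unfolding w_def by (rule trig_space_lincomb(1)[OF v u])
  have fw: "fourier_coeff w k = fourier_coeff v k - fourier_coeff u k" for k
    unfolding w_def trig_space_lincomb(2)[OF v u] by simp
  have pw: "partial j w x = partial j v x - partial j u x" for j x
  proof -
    have "complex_of_real (partial j w x) = complex_of_real (partial j v x - partial j u x)"
      by (simp add: partial_expansion[OF u] partial_expansion[OF v] partial_expansion[OF w] fw
          algebra_simps sum_subtractf)
    then show ?thesis
      by (simp only: of_real_eq_iff)
  qed
  have cont: "continuous_on A u" "continuous_on A v" "continuous_on A w" "continuous_on A ?f"
    "continuous_on A (partial j u)" "continuous_on A (partial j v)" "continuous_on A (partial j w)" for A j
    by (auto simp: ac_f_def intro!: continuous_intros continuous_trig_space[OF u]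
        continuous_trig_space[OF v] continuous_trig_space[OF w]
        continuous_trig_space[OF partial_trig_space[OF u]]
        continuous_trig_space[OF partial_trig_space[OF v]]
        continuous_trig_space[OF partial_trig_space[OF w]])
  have intg: "integrable torus (\<lambda>x. 1/2 * \<nu> * (\<Sum>j\<in>UNIV. (partial j u x)\<^sup>2) + 1/4 * ((u x)\<^sup>2 - 1)\<^sup>2)"
    "integrable torus (\<lambda>x. 1/2 * \<nu> * (\<Sum>j\<in>UNIV. (partial j v x)\<^sup>2) + 1/4 * ((v x)\<^sup>2 - 1)\<^sup>2)"
    "integrable torus (\<lambda>x. \<Sum>j\<in>UNIV. partial j v x * partial j w x)"
    "integrable torus (\<lambda>x. \<Sum>j\<in>UNIV. partial j w x * partial j w x)"
    "integrable torus (\<lambda>x. w x * ?f x)"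
    "integrable torus (\<lambda>x. w x * w x)"
    by (intro integrable_torus_continuous continuous_intros cont)+
  have S: "S \<ge> 0"
    using assms by (simp add: S_def)
  have "energy \<nu> v - energy \<nu> u \<le> (LINT x|torus. \<nu> * (\<Sum>j\<in>UNIV. partial j v x * partial j w x)
      - \<nu> / 2 * (\<Sum>j\<in>UNIV. partial j w x * partial j w x) + w x * ?f x + S * (w x * w x))"
    unfolding energy_def Bochner_Integration.integral_diff[OF intg(2,1), symmetric]
  proof (rule integral_mono_AE)
    show "AE x in torus. 1/2 * \<nu> * (\<Sum>j\<in>UNIV. (partial j v x)\<^sup>2) + 1/4 * ((v x)\<^sup>2 - 1)\<^sup>2
        - (1/2 * \<nu> * (\<Sum>j\<in>UNIV. (partial j u x)\<^sup>2) + 1/4 * ((u x)\<^sup>2 - 1)\<^sup>2)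
      \<le> \<nu> * (\<Sum>j\<in>UNIV. partial j v x * partial j w x)
        - \<nu> / 2 * (\<Sum>j\<in>UNIV. partial j w x * partial j w x) + w x * ?f x + S * (w x * w x)"
      using assms(4,5)
    proof eventually_elim
      case (elim x)
      have "0 \<le> (u x - v x)\<^sup>2"
        by simp
      then have "u x * v x \<le> ((u x)\<^sup>2 + (v x)\<^sup>2) / 2"
        by (simp add: power2_diff)
      with elim have "3/4 * (u x)\<^sup>2 + u x * v x / 2 + (v x)\<^sup>2 / 4 - 1/2 \<le> S"
        by (simp add: S_def)
      then have "(v x - u x)\<^sup>2 * (3/4 * (u x)\<^sup>2 + u x * v x / 2 + (v x)\<^sup>2 / 4 - 1/2) \<le> (v x - u x)\<^sup>2 * S"
        by (rule mult_left_mono) simp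
      then show ?case
        unfolding energy_density_diff pw by (simp add: w_def mult.commute power2_eq_square)
    qed
  qed (intro Bochner_Integration.integrable_diff Bochner_Integration.integrable_add
      integrable_mult_right intg)+
  also have "\<dots> = \<nu> * (LINT x|torus. (\<Sum>j\<in>UNIV. partial j v x * partial j w x))
      - \<nu> / 2 * (LINT x|torus. (\<Sum>j\<in>UNIV. partial j w x * partial j w x))
      + (LINT x|torus. w x * ?f x) + S * (LINT x|torus. w x * w x)"
    using intg(3-6) by simp
  also have "\<dots> = Re (\<Sum>k\<in>modes N.
      \<nu> * laplace_symbol k * (fourier_coeff v k * cnj (fourier_coeff w k))
      - \<nu> / 2 * laplace_symbol k * (fourier_coeff w k * cnj (fourier_coeff w k))
      + fourier_coeff w k * cnj (fourier_coeff ?f k)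
      + S * (fourier_coeff w k * cnj (fourier_coeff w k)))" (is "?L = Re ?R")
  proof -
    have "complex_of_real ?L
        = complex_of_real \<nu> * complex_of_real (LINT x|torus. (\<Sum>j\<in>UNIV. partial j v x * partial j w x))
        - complex_of_real (\<nu> / 2) * complex_of_real (LINT x|torus. (\<Sum>j\<in>UNIV. partial j w x * partial j w x))
        + complex_of_real (LINT x|torus. w x * ?f x)
        + complex_of_real S * complex_of_real (LINT x|torus. w x * w x)"
      by (simp only: of_real_add of_real_diff of_real_mult)
    also have "\<dots> = ?R"
      unfolding dirichlet_form[OF v w] dirichlet_form[OF w w] parseval[OF w cont(4)] parseval[OF w cont(3)]
      by (simp only: sum.distrib sum_subtractf sum_distrib_left mult.assoc of_real_mult)
    finally have "complex_of_real ?L = ?R" .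
    from arg_cong[OF this, of Re] show ?thesis
      unfolding Re_complex_of_real .
  qed
  also have "\<dots> \<le> 0"
    unfolding Re_sum
  proof (rule sum_nonpos)
    fix k assume "k \<in> modes N"
    then have "fourier_coeff w k = - \<tau> * laplace_symbol k * (\<nu> * laplace_symbol k * fourier_coeff v k + fourier_coeff ?f k)"
      unfolding fw by (rule scheme_step_coeff[OF step assms(3)])
    note mode_dissipation[OF assms(2,3) laplace_symbol_nonneg this]
    moreover have "Re (complex_of_real c * z) = c * Re z" for c z
      by simp
    ultimately
    show "Re (\<nu> * laplace_symbol k * (fourier_coeff v k * cnj (fourier_coeff w k))
      - \<nu> / 2 * laplace_symbol k * (fourier_coeff w k * cnj (fourier_coeff w k))
      + fourier_coeff w k * cnj (fourier_coeff ?f k)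
      + S * (fourier_coeff w k * cnj (fourier_coeff w k))) \<le> 0"
      unfolding S_def[symmetric] by (simp only: plus_complex.sel minus_complex.sel)
  qed
  finally show ?thesis
    by simp
qed

section \<open>Norms controlled by the energy\<close>

text \<open>
  Hoelder's inequality from Young's, after normalising both factors.  Positive upper bounds \<open>X\<close> and \<open>Y\<close> take
  the place of the integrals themselves, so that the normalisation never divides by zero.
\<close>
lemma holder_bound:
  fixes f g :: "'a \<Rightarrow> real"
  assumes pq: "p > 1" "q > 1" "1/p + 1/q = 1"
    and f: "integrable M (\<lambda>x. f x powr p)" "\<And>x. f x \<ge> 0" "(LINT x|M. f x powr p) \<le> X" "X > 0"
    and g: "integrable M (\<lambda>x. g x powr q)" "\<And>x. g x \<ge> 0" "(LINT x|M. g x powr q) \<le> Y" "Y > 0"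
  shows "(LINT x|M. f x * g x) \<le> X powr (1/p) * Y powr (1/q)"
proof -
  let ?c = "X powr (1/p) * Y powr (1/q)"
  have c: "?c > 0"
    using f g by simp
  have young: "f x * g x / ?c \<le> f x powr p / (X * p) + g x powr q / (Y * q)" for x
    using Youngs_inequality[of p q "f x / X powr (1/p)" "g x / Y powr (1/q)"] pq f g
    by (simp add: powr_divide powr_powr divide_simps)
  have "(LINT x|M. f x * g x) / ?c = (LINT x|M. f x * g x / ?c)"
    by simp
  also have "\<dots> \<le> (LINT x|M. f x powr p / (X * p) + g x powr q / (Y * q))"
    using pq f g
    by (intro integral_mono_AE' young AE_I2 Bochner_Integration.integrable_add integrable_divide_zero) auto
  also have "\<dots> = (LINT x|M. f x powr p) / X * (1/p) + (LINT x|M. g x powr q) / Y * (1/q)"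
    using f g by simp
  also have "\<dots> \<le> 1 * (1/p) + 1 * (1/q)"
    using pq f g by (intro add_mono mult_right_mono) auto
  finally show ?thesis
    using c pq by (simp add: divide_le_eq)
qed

lemma integral_const_torus: "(LINT x|torus. (c::real)) = c"
proof -
  have "mode 0 = (\<lambda>x. 1)"
    by (simp add: fun_eq_iff mode_def rvec_def inner_vec_def)
  then have "measure torus (space torus) = 1"
    using integral_mode[of 0] by (simp add: scaleR_conv_of_real)
  then show ?thesis
    by simp
qed

text \<open>
  The potential part controls \<open>u\<^sup>2 - 1\<close> in \<open>L\<^sup>2\<close>.  Since the torus has measure one, \<open>\<integral>u\<^sup>2\<close> is at most the square
  root of \<open>X = \<integral>u\<^sup>4\<close>, so \<open>(sqrt X - 1)\<^sup>2\<close> is at most \<open>\<integral>(u\<^sup>2 - 1)\<^sup>2\<close>.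
\<close>
lemma energy_bounds:
  assumes u: "u \<in> trig_space N" and "\<nu> > 0"
  shows "energy \<nu> u \<ge> 0" (is ?A)
    and "(LINT x|torus. ((u x)\<^sup>2 - 1)\<^sup>2) \<le> 4 * energy \<nu> u" (is ?B)
    and "(LINT x|torus. (u x) ^ 4) \<le> (1 + 2 * sqrt (energy \<nu> u))\<^sup>2" (is ?C)
proof -
  note c = continuous_trig_space[OF u] continuous_trig_space[OF partial_trig_space[OF u]]
  have "(LINT x|torus. ((u x)\<^sup>2 - 1)\<^sup>2) / 4 = (LINT x|torus. ((u x)\<^sup>2 - 1)\<^sup>2 / 4)"
    by simp
  also have "\<dots> \<le> energy \<nu> u"
    unfolding energy_def
    by (intro integral_mono integrable_torus_continuous continuous_intros c)
       (use assms in \<open>auto intro!: mult_nonneg_nonneg sum_nonneg\<close>)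
  finally show B: ?B
    by simp
  have nn: "0 \<le> (LINT x|torus. ((u x)\<^sup>2 - 1)\<^sup>2)"
    by simp
  from nn B show A: ?A
    by linarith
  define X where "X = (LINT x|torus. (u x) ^ 4)"
  define Z where "Z = (LINT x|torus. (u x)\<^sup>2)"
  have i: "integrable torus (\<lambda>x. (u x) ^ 4)" "integrable torus (\<lambda>x. (u x)\<^sup>2)"
    by (intro integrable_torus_continuous continuous_intros c)+
  have sq: "(LINT x|torus. ((u x)\<^sup>2 - a)\<^sup>2) = X - 2 * a * Z + a\<^sup>2" for a
  proof -
    have "(LINT x|torus. ((u x)\<^sup>2 - a)\<^sup>2) = (LINT x|torus. ((u x) ^ 4 - 2 * a * (u x)\<^sup>2) + a\<^sup>2)"
      by (intro Bochner_Integration.integral_cong) (simp_all add: power2_diff)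
    also have "\<dots> = (LINT x|torus. (u x) ^ 4 - 2 * a * (u x)\<^sup>2) + (LINT x|torus. a\<^sup>2)"
      by (intro Bochner_Integration.integral_add integrable_torus_continuous continuous_intros c)
    also have "(LINT x|torus. (u x) ^ 4 - 2 * a * (u x)\<^sup>2) = X - 2 * a * Z"
      using i by (simp add: X_def Z_def)
    finally show ?thesis
      unfolding integral_const_torus .
  qed
  have X: "X \<ge> 0"
    by (simp add: X_def)
  \<comment> \<open>Nonnegativity of the variance of \<open>u\<^sup>2\<close> serves as the Cauchy--Schwarz inequality.\<close>
  have "0 \<le> (LINT x|torus. ((u x)\<^sup>2 - Z)\<^sup>2)"
    by simp
  then have "Z\<^sup>2 \<le> X"
    unfolding sq by (simp add: power2_eq_square)
  then have "Z \<le> sqrt X"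
    by (rule real_le_rsqrt)
  then have "(sqrt X - 1)\<^sup>2 \<le> 4 * energy \<nu> u"
    using B X unfolding sq by (simp add: power2_diff)
  then have "sqrt X - 1 \<le> 2 * sqrt (energy \<nu> u)"
    using real_le_rsqrt[of "sqrt X - 1" "4 * energy \<nu> u"] by (simp add: real_sqrt_mult)
  then have "sqrt X \<le> 1 + 2 * sqrt (energy \<nu> u)"
    by simp
  then have "(sqrt X)\<^sup>2 \<le> (1 + 2 * sqrt (energy \<nu> u))\<^sup>2"
    using X by (intro power_mono) auto
  then show ?C
    using X by (simp add: X_def)
qed

lemma continuous_in_Lp:
  assumes "continuous_on UNIV g" "p > 0"
  shows "in_Lp p g"
  unfolding in_Lp_def using assms
  by (intro conjI borel_measurable_torus borel_measurable_continuous_onI integrable_torus_continuous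
      continuous_on_powr' continuous_intros) auto

lemma L4_norm_bound:
  assumes u: "u \<in> trig_space N" and "\<nu> > 0" and E: "energy \<nu> u \<le> E0"
  shows "Lp_norm 4 u \<le> sqrt (1 + 2 * sqrt E0)"
proof -
  have E': "0 \<le> E0" "0 \<le> energy \<nu> u"
    using E energy_bounds(1)[OF u assms(2)] by auto
  have "(LINT x|torus. (u x) ^ 4) \<le> (1 + 2 * sqrt (energy \<nu> u))\<^sup>2"
    by (rule energy_bounds(3)[OF u assms(2)])
  also have "\<dots> \<le> (1 + 2 * sqrt E0)\<^sup>2"
    using E E' by (intro power_mono) auto
  also have "\<dots> = sqrt (1 + 2 * sqrt E0) powr 4"
    using E' power_mult[of "sqrt (1 + 2 * sqrt E0)" 2 2] by simp
  finally have "(LINT x|torus. \<bar>u x\<bar> powr 4) \<le> sqrt (1 + 2 * sqrt E0) powr 4"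
    by simp
  then have "Lp_norm 4 u \<le> (sqrt (1 + 2 * sqrt E0) powr 4) powr (1/4)"
    unfolding Lp_norm_def by (intro powr_mono2) auto
  also have "\<dots> = sqrt (1 + 2 * sqrt E0)"
    using E' by (simp only: powr_powr) simp
  finally show ?thesis .
qed

text \<open>
  Since \<open>f(u) = u (u\<^sup>2 - 1)\<close>, Hoelder's inequality with exponents \<open>3\<close> and \<open>3/2\<close>, applied to the powers \<open>4/3\<close> of the
  factors, bounds the norm by that of \<open>u\<close> in \<open>L\<^sup>4\<close> times that of \<open>u\<^sup>2 - 1\<close> in \<open>L\<^sup>2\<close>.
\<close>
lemma ac_f_L43_norm_bound:
  assumes u: "u \<in> trig_space N" and "\<nu> > 0" and E: "energy \<nu> u \<le> E0" and "E0 > 0"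
  shows "Lp_norm (4/3) (\<lambda>x. ac_f (u x)) \<le> 2 * sqrt E0 * sqrt (1 + 2 * sqrt E0)"
proof -
  note c = continuous_trig_space[OF u]
  define A where "A = sqrt (1 + 2 * sqrt E0)"
  define B where "B = 2 * sqrt E0"
  have A: "A > 0" and B: "B > 0"
    using assms by (auto simp: A_def B_def add_pos_pos)
  have E': "0 \<le> energy \<nu> u"
    using energy_bounds(1)[OF u assms(2)] by auto
  have "(LINT x|torus. (u x) ^ 4) \<le> (1 + 2 * sqrt (energy \<nu> u))\<^sup>2"
    by (rule energy_bounds(3)[OF u assms(2)])
  also have "\<dots> \<le> (1 + 2 * sqrt E0)\<^sup>2"
    using E E' by (intro power_mono) auto
  also have "\<dots> = A powr 4"
    using assms(4) A power_mult[of "sqrt (1 + 2 * sqrt E0)" 2 2] by (simp add: A_def)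
  finally have X: "(LINT x|torus. (\<bar>u x\<bar> powr (4/3)) powr 3) \<le> A powr 4"
    by (simp add: powr_powr)
  have "(LINT x|torus. ((u x)\<^sup>2 - 1)\<^sup>2) \<le> 4 * energy \<nu> u"
    by (rule energy_bounds(2)[OF u assms(2)])
  also have "\<dots> \<le> B powr 2"
    using E assms(4) B by (simp add: B_def power_mult_distrib)
  finally have Y: "(LINT x|torus. (\<bar>(u x)\<^sup>2 - 1\<bar> powr (4/3)) powr (3/2)) \<le> B powr 2"
    by (simp add: powr_powr)
  have "(LINT x|torus. \<bar>ac_f (u x)\<bar> powr (4/3))
      = (LINT x|torus. \<bar>u x\<bar> powr (4/3) * \<bar>(u x)\<^sup>2 - 1\<bar> powr (4/3))"
  proof -
    have "\<bar>ac_f t\<bar> = \<bar>t\<bar> * \<bar>t\<^sup>2 - 1\<bar>" for t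
      by (simp add: ac_f_def power2_eq_square power3_eq_cube algebra_simps flip: abs_mult)
    then show ?thesis
      by (simp add: powr_mult)
  qed
  also have "\<dots> \<le> (A powr 4) powr (1/3) * (B powr 2) powr (1/(3/2))"
  proof (rule holder_bound)
    have "continuous_on UNIV (\<lambda>x. (\<bar>u x\<bar> powr (4/3)) powr 3)"
      "continuous_on UNIV (\<lambda>x. (\<bar>(u x)\<^sup>2 - 1\<bar> powr (4/3)) powr (3/2))"
      by (intro continuous_on_powr' continuous_intros c; simp)+
    then show "integrable torus (\<lambda>x. (\<bar>u x\<bar> powr (4/3)) powr 3)"
      "integrable torus (\<lambda>x. (\<bar>(u x)\<^sup>2 - 1\<bar> powr (4/3)) powr (3/2))"
      by (simp_all only: integrable_torus_continuous)
  qed (use A B X Y in auto)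
  also have "\<dots> = A powr (4/3) * B powr (4/3)"
    by (simp only: powr_powr) simp
  also have "\<dots> = (A * B) powr (4/3)"
    using A B by (simp add: powr_mult)
  finally have "Lp_norm (4/3) (\<lambda>x. ac_f (u x)) \<le> ((A * B) powr (4/3)) powr (1/(4/3))"
    unfolding Lp_norm_def by (intro powr_mono2) auto
  also have "\<dots> = A * B"
    using A B by (simp add: powr_powr)
  finally show ?thesis
    by (simp add: A_def B_def mult.commute)
qed

section \<open>Sup bound for one step of the scheme\<close>

text \<open>
  Solving the implicit step for \<open>v\<close> on each mode gives exactly the two multipliers for which sup bounds are
  assumed.
\<close>
lemma scheme_step_resolvent:
  assumes step: "scheme_step N \<nu> \<tau> u v" and "\<nu> > 0" "\<tau> > 0"
  shows "v x = resolvent \<nu> \<tau> u x + laplace_resolvent \<nu> \<tau> (proj N (\<lambda>y. ac_f (u y))) x"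
proof -
  let ?f = "\<lambda>y. ac_f (u y)"
  have u: "u \<in> trig_space N" and v: "v \<in> trig_space N"
    using step by (auto simp: scheme_step_def)
  have norm4: "(2 * pi * norm (rvec k)) ^ 4 = (laplace_symbol k)\<^sup>2" for k
    by (simp add: laplace_symbol_def flip: power_mult)
  have even: "laplace_symbol (- k) = laplace_symbol k" for k
    by (simp add: laplace_symbol_eq)
  define m where "m k = 1 / (1 + \<nu> * \<tau> * (laplace_symbol k)\<^sup>2)" for k
  have 1: "complex_of_real (resolvent \<nu> \<tau> u x)
      = (\<Sum>k\<in>modes N. (complex_of_real (m k) * fourier_coeff u k) * mode k x)"
    unfolding resolvent_def norm4 m_def
    by (rule fourier_multiplier_finite_support) (auto simp: even fourier_coeff_eq_0[OF u])
  have 2: "complex_of_real (laplace_resolvent \<nu> \<tau> (proj N ?f) x)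
      = (\<Sum>k\<in>modes N. (complex_of_real (- \<tau> * laplace_symbol k * m k) * fourier_coeff ?f k) * mode k x)"
    unfolding laplace_resolvent_def norm4 m_def laplace_symbol_def[symmetric]
    by (subst fourier_multiplier_finite_support[where N = N]) (auto simp: even fourier_coeff_proj)
  have "fourier_coeff v k = complex_of_real (m k) * fourier_coeff u k
      + complex_of_real (- \<tau> * laplace_symbol k * m k) * fourier_coeff ?f k" if "k \<in> modes N" for k
  proof -
    have "1 + \<nu> * \<tau> * (laplace_symbol k)\<^sup>2 > 0"
      using assms by (intro add_pos_nonneg) auto
    then have m: "complex_of_real (m k) * complex_of_real (1 + \<nu> * \<tau> * (laplace_symbol k)\<^sup>2) = 1"
      unfolding m_def of_real_mult[symmetric] by simp
    have "complex_of_real (1 + \<nu> * \<tau> * (laplace_symbol k)\<^sup>2) * fourier_coeff v k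
        = fourier_coeff u k - \<tau> * laplace_symbol k * fourier_coeff ?f k"
      using scheme_step_coeff[OF step assms(3) that] by (simp add: algebra_simps power2_eq_square)
    then have "complex_of_real (m k) * (complex_of_real (1 + \<nu> * \<tau> * (laplace_symbol k)\<^sup>2) * fourier_coeff v k)
        = complex_of_real (m k) * (fourier_coeff u k - \<tau> * laplace_symbol k * fourier_coeff ?f k)"
      by simp
    then show ?thesis
      unfolding mult.assoc[symmetric] m by (simp add: algebra_simps)
  qed
  then have "complex_of_real (v x)
      = complex_of_real (resolvent \<nu> \<tau> u x + laplace_resolvent \<nu> \<tau> (proj N ?f) x)"
    unfolding of_real_add 1 2 trig_space_expansion[OF v]
    by (simp add: sum.distrib[symmetric] ring_distribs)
  then show ?thesis
    by (simp only: of_real_eq_iff)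
qed

lemma mean_zero_iff_coeff: "mean_zero g \<longleftrightarrow> fourier_coeff g 0 = 0"
proof -
  have "mode 0 = (\<lambda>x. 1)"
    by (simp add: fun_eq_iff mode_def rvec_def inner_vec_def)
  then show ?thesis
    by (simp add: mean_zero_def fourier_coeff_eq)
qed

lemma zero_in_modes: "0 \<in> modes N"
  by (simp add: modes_def)

text \<open>
  The right-hand side of the scheme is a Laplacian, so it has no zero mode.
\<close>
lemma mean_zero_scheme_step:
  assumes "scheme_step N \<nu> \<tau> u v" "\<tau> > 0" "mean_zero u"
  shows "mean_zero v"
  using scheme_step_coeff[OF assms(1,2) zero_in_modes] assms(3)
  by (simp add: mean_zero_iff_coeff laplace_symbol_eq)

lemma AE_le_Linf_norm:
  assumes "Linf_norm g \<le> ereal c"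
  shows "AE x in torus. \<bar>g x\<bar> \<le> c"
  using esssup_AE[where M = torus and f = "\<lambda>x. ereal \<bar>g x\<bar>"]
  by eventually_elim (use assms in \<open>metis Linf_norm_def ereal_less_eq(3) order_trans\<close>)

text \<open>
  With \<open>a\<close> and \<open>b\<close> the two summands and \<open>s = sqrt (\<nu>/\<tau>)\<close>, the two restrictions on \<open>\<tau>\<close> become
  \<open>a\<^sup>8 \<le> 0.04 s\<^sup>4\<close> and \<open>b\<^sup>8 \<le> 0.04\<^sup>3 s\<^sup>4\<close>.  Hence \<open>(a + b)\<^sup>2 / s\<close> is at most the square of the sum of the powers \<open>1/8\<close>
  and \<open>3/8\<close> of \<open>0.04\<close>, about \<open>0.937\<close>, and this stays just below \<open>(2/3) sqrt 2\<close>, about \<open>0.943\<close>.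
\<close>
lemma step_size_bound:
  fixes \<alpha>1 \<alpha>2 \<nu> \<tau> :: real
  assumes "\<alpha>1 > 0" "\<alpha>2 > 0" "\<nu> > 0" "\<tau> > 0"
    and t1: "\<tau> \<le> 0.04 * \<nu> ^ 3 * \<alpha>1 powr (- 8)"
    and t2: "\<tau> \<le> 0.04 * \<nu> ^ 3 * \<alpha>2 powr (- 8/3)"
  shows "(\<alpha>1 * (\<nu> * \<tau>) powr (- 1/8) + \<alpha>2 * \<tau> * (\<nu> * \<tau>) powr (- 7/8))\<^sup>2 \<le> 2/3 * sqrt (2 * \<nu> / \<tau>)"
proof -
  define a where "a = \<alpha>1 * (\<nu> * \<tau>) powr (- 1/8)"
  define b where "b = \<alpha>2 * \<tau> * (\<nu> * \<tau>) powr (- 7/8)"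
  define s where "s = sqrt (\<nu> / \<tau>)"
  have pos: "a > 0" "b > 0" "s > 0"
    using assms by (auto simp: a_def b_def s_def)
  have s4: "s ^ 4 = \<nu>\<^sup>2 / \<tau>\<^sup>2"
    using assms power_mult[of s 2 2] by (simp add: s_def power_divide)
  have pw: "(x powr y) ^ 8 = x powr (8 * y)" if "x > 0" for x y :: real
    using that by (simp add: powr_powr mult.commute flip: powr_realpow)
  have "a ^ 8 = \<alpha>1 ^ 8 / (\<nu> * \<tau>)"
    unfolding a_def power_mult_distrib using assms by (subst pw) (auto simp: powr_minus divide_simps)
  also have "\<dots> \<le> (0.04 * \<nu> ^ 3 / \<tau>) / (\<nu> * \<tau>)"
    using t1 assms by (intro divide_right_mono) (simp_all add: powr_minus divide_simps mult_ac)
  also have "\<dots> = 0.04 * s ^ 4"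
    unfolding s4 using assms by (simp add: divide_simps power2_eq_square power3_eq_cube)
  \<comment> \<open>\<open>0.448\<close> rounds up the fourth root of \<open>0.04\<close>.\<close>
  also have "\<dots> \<le> 0.448 ^ 4 * s ^ 4"
    by (intro mult_right_mono) (simp_all add: power_divide)
  also have "\<dots> = (0.448 * s) ^ 4"
    by (simp only: power_mult_distrib)
  also have "a ^ 8 = (a\<^sup>2) ^ 4"
    by (simp flip: power_mult)
  finally have a: "a\<^sup>2 \<le> 0.448 * s"
    by (rule iffD1[OF power_mono_iff, rotated 3]) (use pos in auto)
  have "b ^ 8 = \<alpha>2 ^ 8 * \<tau> ^ 8 / (\<nu> * \<tau>) ^ 7"
    unfolding b_def power_mult_distrib[of _ "(\<nu> * \<tau>) powr _"] using assms
    by (subst pw) (auto simp: powr_minus divide_simps power_mult_distrib)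
  also have "\<dots> = \<alpha>2 ^ 8 * (\<tau> / \<nu> ^ 7)"
    using assms power_Suc[of \<tau> 7] by (simp add: power_mult_distrib)
  also have "\<dots> \<le> (0.000064 * \<nu> ^ 9 / \<tau> ^ 3) * (\<tau> / \<nu> ^ 7)"
  proof (rule mult_right_mono)
    have "\<tau> ^ 3 \<le> (0.04 * \<nu> ^ 3 * \<alpha>2 powr (- 8/3)) ^ 3"
      using t2 assms by (intro power_mono) auto
    also have "\<dots> = 0.000064 * \<nu> ^ 9 * (\<alpha>2 powr (- 8/3)) ^ 3"
      by (simp add: power_mult_distrib power_divide flip: power_mult)
    also have "(\<alpha>2 powr (- 8/3)) ^ 3 = 1 / \<alpha>2 ^ 8"
    proof -
      have "(\<alpha>2 powr (- 8/3)) ^ 3 = (\<alpha>2 powr (- 8/3)) powr 3"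
        using assms by (subst powr_numeral) auto
      also have "\<dots> = \<alpha>2 powr (- 8)"
        by (simp only: powr_powr) simp
      finally show ?thesis
        using assms by (simp add: powr_minus divide_simps)
    qed
    finally show "\<alpha>2 ^ 8 \<le> 0.000064 * \<nu> ^ 9 / \<tau> ^ 3"
      using assms by (simp add: divide_simps mult_ac)
  qed (use assms in simp)
  also have "\<dots> = 0.000064 * s ^ 4"
  proof -
    have "\<nu> ^ 9 = \<nu>\<^sup>2 * \<nu> ^ 7"
      by (simp flip: power_add)
    then show ?thesis
      unfolding s4 using assms by (simp add: power2_eq_square power3_eq_cube)
  qed
  \<comment> \<open>\<open>0.0895\<close> rounds up the fourth root of \<open>0.04\<^sup>3\<close>.\<close>
  also have "\<dots> \<le> 0.0895 ^ 4 * s ^ 4"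
    by (intro mult_right_mono) (simp_all add: power_divide)
  also have "\<dots> = (0.0895 * s) ^ 4"
    by (simp only: power_mult_distrib)
  also have "b ^ 8 = (b\<^sup>2) ^ 4"
    by (simp flip: power_mult)
  finally have b: "b\<^sup>2 \<le> 0.0895 * s"
    by (rule iffD1[OF power_mono_iff, rotated 3]) (use pos in auto)
  have "(a * b)\<^sup>2 \<le> (0.2003 * s)\<^sup>2"
  proof -
    have "a\<^sup>2 * b\<^sup>2 \<le> (0.448 * s) * (0.0895 * s)"
      using a b pos by (intro mult_mono) auto
    also have "\<dots> \<le> (0.2003 * s)\<^sup>2"
      using pos by (simp add: power2_eq_square)
    finally show ?thesis
      by (simp add: power_mult_distrib)
  qed
  then have ab: "a * b \<le> 0.2003 * s"
    using pos by (simp add: power2_le_iff_abs_le)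
  have "(a + b)\<^sup>2 \<le> 0.94 * s"
    using a b ab pos by (simp add: power2_sum)
  also have "\<dots> \<le> 2/3 * (sqrt 2 * s)"
  proof -
    have "1.41 \<le> sqrt 2"
      by (rule real_le_rsqrt) (simp add: power2_eq_square)
    then have "1.41 * s \<le> sqrt 2 * s"
      using pos by (intro mult_right_mono) auto
    then show ?thesis by simp
  qed
  also have "sqrt 2 * s = sqrt (2 * \<nu> / \<tau>)"
    unfolding s_def by (simp flip: real_sqrt_mult)
  finally show ?thesis
    by (simp add: a_def b_def)
qed

text \<open>
  The new iterate is bounded by norms of the old one that the energy controls, so the bound does not
  deteriorate from step to step as long as the energy stays below \<open>E0\<close>.
\<close>
lemma scheme_step_sup_bound:
  assumes res: "\<And>\<nu>' \<tau>' g. \<lbrakk>\<nu>' > 0; \<tau>' > 0; in_Lp 4 g; mean_zero g\<rbrakk> \<Longrightarrow>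
      Linf_norm (resolvent \<nu>' \<tau>' g) \<le> ereal (C1 * (\<nu>' * \<tau>') powr (- 1/8) * Lp_norm 4 g)"
    and lap: "\<And>M \<nu>' \<tau>' g. \<lbrakk>M \<ge> 2; \<nu>' > 0; \<tau>' > 0; in_Lp (4/3) g\<rbrakk> \<Longrightarrow>
      Linf_norm (laplace_resolvent \<nu>' \<tau>' (proj M g))
        \<le> ereal (C2 * \<tau>' * (\<nu>' * \<tau>') powr (- 7/8) * Lp_norm (4/3) g)"
    and C: "C1 > 0" "C2 > 0" and N: "N \<ge> 2"
    and step: "scheme_step N \<nu> \<tau> u v" and pos: "\<nu> > 0" "\<tau> > 0"
    and mz: "mean_zero u" and E: "energy \<nu> u \<le> E0" "E0 > 0"
  shows "AE x in torus. \<bar>v x\<bar> \<le> C1 * sqrt (1 + 2 * sqrt E0) * (\<nu> * \<tau>) powr (- 1/8)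
    + 2 * C2 * sqrt E0 * sqrt (1 + 2 * sqrt E0) * \<tau> * (\<nu> * \<tau>) powr (- 7/8)"
proof -
  let ?f = "\<lambda>y. ac_f (u y)"
  have u: "u \<in> trig_space N"
    using step by (auto simp: scheme_step_def)
  have c: "continuous_on UNIV u" "continuous_on UNIV ?f"
    unfolding ac_f_def by (intro continuous_intros continuous_trig_space[OF u])+
  have "AE x in torus. \<bar>resolvent \<nu> \<tau> u x\<bar> \<le> C1 * (\<nu> * \<tau>) powr (- 1/8) * Lp_norm 4 u"
    by (intro AE_le_Linf_norm res pos mz continuous_in_Lp c) simp
  moreover have "AE x in torus. \<bar>laplace_resolvent \<nu> \<tau> (proj N ?f) x\<bar>
      \<le> C2 * \<tau> * (\<nu> * \<tau>) powr (- 7/8) * Lp_norm (4/3) ?f"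
    by (intro AE_le_Linf_norm lap pos N continuous_in_Lp c) simp
  ultimately show ?thesis
  proof eventually_elim
    case (elim x)
    have "\<bar>v x\<bar> \<le> \<bar>resolvent \<nu> \<tau> u x\<bar> + \<bar>laplace_resolvent \<nu> \<tau> (proj N ?f) x\<bar>"
      unfolding scheme_step_resolvent[OF step pos] by (rule abs_triangle_ineq)
    also note elim(1)
    also note elim(2)
    also have "C1 * (\<nu> * \<tau>) powr (- 1/8) * Lp_norm 4 u
        \<le> C1 * (\<nu> * \<tau>) powr (- 1/8) * sqrt (1 + 2 * sqrt E0)"
      using C L4_norm_bound[OF u pos(1) E(1)] by (intro mult_left_mono) auto
    also have "C2 * \<tau> * (\<nu> * \<tau>) powr (- 7/8) * Lp_norm (4/3) ?f
        \<le> C2 * \<tau> * (\<nu> * \<tau>) powr (- 7/8) * (2 * sqrt E0 * sqrt (1 + 2 * sqrt E0))"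
      using C pos ac_f_L43_norm_bound[OF u pos(1) E] by (intro mult_left_mono) auto
    finally show ?case
      by (simp add: mult_ac)
  qed
qed

text \<open>
  The initial datum is not produced by a step of the scheme, so its sup norm enters through a separate
  restriction on \<open>\<tau>\<close>.
\<close>
lemma initial_sup_bound:
  fixes a L \<nu> \<tau> :: real
  assumes "\<bar>a\<bar> \<le> L" "\<nu> > 0" "\<tau> > 0" "L \<noteq> 0" "\<tau> \<le> 8 * \<nu> / (9 * L ^ 4)"
  shows "a\<^sup>2 \<le> 2/3 * sqrt (2 * \<nu> / \<tau>)"
proof -
  have "L ^ 4 > 0"
    using assms by simp
  then have "(3/2 * L\<^sup>2)\<^sup>2 \<le> 2 * \<nu> / \<tau>"
    using assms(3,5) by (simp add: power_mult_distrib power_divide divide_simps mult_ac flip: power_mult)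
  then have "3/2 * L\<^sup>2 \<le> sqrt (2 * \<nu> / \<tau>)"
    by (rule real_le_rsqrt)
  moreover have "a\<^sup>2 \<le> L\<^sup>2"
    using assms(1) power_mono[of "\<bar>a\<bar>" L 2] by simp
  ultimately show ?thesis
    by simp
qed

section \<open>Energy stability\<close>

theorem theorem5p3:
  fixes C1 C2 \<nu> \<tau> L0 E0 \<alpha>1 \<alpha>2 \<tau>max1 \<tau>max :: real
    and N :: nat
    and u0 :: "real^2 \<Rightarrow> real"
    and u :: "nat \<Rightarrow> real^2 \<Rightarrow> real"
  assumes "C1 > 0" and "C2 > 0"
    and "\<And>\<nu>' \<tau>' g. \<lbrakk>\<nu>' > 0; \<tau>' > 0; in_Lp 4 g; mean_zero g\<rbrakk> \<Longrightarrow>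
      Linf_norm (resolvent \<nu>' \<tau>' g) \<le> ereal (C1 * (\<nu>' * \<tau>') powr (- 1/8) * Lp_norm 4 g)"
    and "\<And>M \<nu>' \<tau>' g. \<lbrakk>M \<ge> 2; \<nu>' > 0; \<tau>' > 0; in_Lp (4/3) g\<rbrakk> \<Longrightarrow>
      Linf_norm (laplace_resolvent \<nu>' \<tau>' (proj M g))
        \<le> ereal (C2 * \<tau>' * (\<nu>' * \<tau>') powr (- 7/8) * Lp_norm (4/3) g)"
    and "\<nu> > 0" and "N \<ge> 2"
    and "in_H1 u0" and "mean_zero u0"
    and "Linf_norm (proj N u0) = ereal L0" and "L0 \<noteq> 0"
    and "E0 = energy \<nu> (proj N u0)"
    and "\<alpha>1 = C1 * sqrt (1 + 2 * sqrt E0)"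
    and "\<alpha>2 = 2 * C2 * sqrt E0 * sqrt (1 + 2 * sqrt E0)"
    and "\<tau>max1 = 0.04 * \<nu> ^ 3 * min (\<alpha>1 powr (- 8)) (\<alpha>2 powr (- 8/3))"
    and "\<tau>max = min (8 * \<nu> / (9 * L0 ^ 4)) \<tau>max1"
    and "0 < \<tau>" and "\<tau> \<le> \<tau>max"
    and "u 0 = proj N u0"
    and "\<And>n. u (Suc n) \<in> trig_space N"
    and "\<And>n x. (u (Suc n) x - u n x) / \<tau> =
      - \<nu> * laplacian (laplacian (u (Suc n))) x + laplacian (proj N (\<lambda>y. ac_f (u n y))) x"
  shows "\<forall>n. energy \<nu> (u (Suc n)) \<le> energy \<nu> (u n)"
proof -
  have E0_nonneg: "E0 \<ge> 0"
    using energy_bounds(1)[OF proj_trig_space \<open>\<nu> > 0\<close>] assms by simp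
  have "\<tau> \<le> \<tau>max1" and \<tau>0: "\<tau> \<le> 8 * \<nu> / (9 * L0 ^ 4)"
    using assms by auto
  then have "0 < 0.04 * \<nu> ^ 3 * min (\<alpha>1 powr (- 8)) (\<alpha>2 powr (- 8/3))"
    using assms by simp
  then have "0 < min (\<alpha>1 powr (- 8)) (\<alpha>2 powr (- 8/3))"
    using \<open>\<nu> > 0\<close> by (simp add: zero_less_mult_iff)
  \<comment> \<open>Zero raised to a negative power is zero here, so a vanishing \<open>E0\<close> would leave no admissible step size.\<close>
  then have "\<alpha>2 \<noteq> 0"
    by auto
  then have E0: "E0 > 0" and \<alpha>: "\<alpha>1 > 0" "\<alpha>2 > 0"
    using E0_nonneg assms by (auto simp: add_pos_nonneg)
  have "0.04 * \<nu> ^ 3 * min (\<alpha>1 powr (- 8)) (\<alpha>2 powr (- 8/3)) \<le> 0.04 * \<nu> ^ 3 * \<alpha>1 powr (- 8)"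
    "0.04 * \<nu> ^ 3 * min (\<alpha>1 powr (- 8)) (\<alpha>2 powr (- 8/3)) \<le> 0.04 * \<nu> ^ 3 * \<alpha>2 powr (- 8/3)"
    using \<open>\<nu> > 0\<close> by (intro mult_left_mono; simp)+
  with \<open>\<tau> \<le> \<tau>max1\<close> have \<tau>12: "\<tau> \<le> 0.04 * \<nu> ^ 3 * \<alpha>1 powr (- 8)" "\<tau> \<le> 0.04 * \<nu> ^ 3 * \<alpha>2 powr (- 8/3)"
    using \<open>\<tau>max1 = _\<close> by linarith+
  have trig: "u n \<in> trig_space N" for n
    using proj_trig_space assms(18,19) by (cases n) auto
  have step: "scheme_step N \<nu> \<tau> (u n) (u (Suc n))" for n
    using trig assms(20) by (auto simp: scheme_step_def)
  let ?K = "2/3 * sqrt (2 * \<nu> / \<tau>)"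
  have sup: "AE x in torus. (u (Suc n) x)\<^sup>2 \<le> ?K" if "mean_zero (u n)" "energy \<nu> (u n) \<le> E0" for n
  proof -
    have "AE x in torus. \<bar>u (Suc n) x\<bar>
        \<le> \<alpha>1 * (\<nu> * \<tau>) powr (- 1/8) + \<alpha>2 * \<tau> * (\<nu> * \<tau>) powr (- 7/8)"
      unfolding assms(12,13)
      by (rule scheme_step_sup_bound[where N = N and u = "u n"]; fact that step E0 assms)
    then show ?thesis
    proof eventually_elim
      case (elim x)
      then have "\<bar>u (Suc n) x\<bar>\<^sup>2 \<le> (\<alpha>1 * (\<nu> * \<tau>) powr (- 1/8) + \<alpha>2 * \<tau> * (\<nu> * \<tau>) powr (- 7/8))\<^sup>2"
        by (intro power_mono) auto
      also have "\<dots> \<le> ?K"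
        by (rule step_size_bound[OF \<alpha> \<open>\<nu> > 0\<close> \<open>\<tau> > 0\<close> \<tau>12])
      finally show ?case
        by simp
    qed
  qed
  have inv: "mean_zero (u n) \<and> energy \<nu> (u n) \<le> E0 \<and> (AE x in torus. (u n x)\<^sup>2 \<le> ?K)" for n
  proof (induction n)
    case 0
    have "mean_zero (u 0)"
      using \<open>mean_zero u0\<close> unfolding \<open>u 0 = _\<close> mean_zero_iff_coeff by (simp add: fourier_coeff_proj)
    moreover have "AE x in torus. \<bar>u 0 x\<bar> \<le> L0"
      using assms(9) unfolding \<open>u 0 = _\<close> by (intro AE_le_Linf_norm) simp
    then have "AE x in torus. (u 0 x)\<^sup>2 \<le> ?K"
      by eventually_elim (rule initial_sup_bound[OF _ \<open>\<nu> > 0\<close> \<open>\<tau> > 0\<close> \<open>L0 \<noteq> 0\<close> \<tau>0])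
    ultimately show ?case
      using assms(11,18) by simp
  next
    case (Suc n)
    then show ?case
      using mean_zero_scheme_step[OF step \<open>\<tau> > 0\<close>] sup[of n]
        energy_decay[OF step \<open>\<nu> > 0\<close> \<open>\<tau> > 0\<close>, of n] by force
  qed
  show ?thesis
    using inv energy_decay[OF step \<open>\<nu> > 0\<close> \<open>\<tau> > 0\<close>] by blast
qed

end
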